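(* Let $2 \leq p \leq \infty$ and let $X$ and $Y$ be totally ordered sets with cardinality at least $p$ (infinite if $p = \infty$). Let $\mathscr{F}^{\mathrm{TN}}_{X,Y}(p)$ be the set of functions $F : [0,\infty) \to \mathbb{R}$ such that $F \circ K$ is $\mathrm{TN}_p$ for every $\mathrm{TN}_p$ kernel $K$ on $X \times Y$. Then, as sets of functions of $x \in [0,\infty)$: (1) if $p = 2$, $\mathscr{F}^{\mathrm{TN}}_{X,Y}(2) = \{ c x^\alpha : c > 0, \ \alpha > 0 \} \cup \{ c : c \geq 0 \} \cup \{ c\,\mathbf{1}_{x > 0} : c > 0 \}$; (2) if $p = 3$, $\mathscr{F}^{\mathrm{TN}}_{X,Y}(3) = \{ c x^\alpha : c > 0, \ \alpha \geq 1 \} \cup \{ c : c \geq 0 \}$; (3) if $4 \leq p \leq \infty$, $\mathscr{F}^{\mathrm{TN}}_{X,Y}(p) = \{ c x : c > 0 \} \cup \{ c : c \geq 0 \}$.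
   Context: For totally ordered sets $X$ and $Y$ and an integer $p \geq 1$, a kernel $K : X \times Y \to \mathbb{R}$ is $\mathrm{TN}_p$ if $\det(K(x_i, y_j))_{i,j=1}^n \geq 0$ for all $1 \leq n \leq p$ and all $x_1 < \cdots < x_n$ in $X$ and $y_1 < \cdots < y_n$ in $Y$. It is $\mathrm{TN}_\infty$ (also written $\mathrm{TN}$) if it is $\mathrm{TN}_p$ for all integers $p \geq 1$. $\mathbf{1}_{x>0}$ equals $1$ if $x > 0$ and $0$ if $x = 0$. *)

theory Defs
  imports
    Complex_Main
    "HOL-Library.Extended_Nat"
    "HOL-Library.FuncSet"
    "Jordan_Normal_Form.Determinant"
begin

text \<open>
  A totally ordered set is a set of elements of a linearly ordered type; a kernel on
  \<open>X \<times> Y\<close> is a curried function of which only the values on \<open>X \<times> Y\<close> matter.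
  Tuples \<open>x\<^sub>1 < \<dots> < x\<^sub>n\<close> in \<open>X\<close> are functions on the index set \<open>{..<n}\<close>.
\<close>

definition TN_fin ::
  "nat \<Rightarrow> 'a::linorder set \<Rightarrow> 'b::linorder set \<Rightarrow> ('a \<Rightarrow> 'b \<Rightarrow> real) \<Rightarrow> bool"
where
  "TN_fin p X Y K \<longleftrightarrow>
     (\<forall>n x y. 1 \<le> n \<and> n \<le> p \<and>
        x \<in> {..<n} \<rightarrow> X \<and> strict_mono_on {..<n} x \<and>
        y \<in> {..<n} \<rightarrow> Y \<and> strict_mono_on {..<n} y \<longrightarrow>
        0 \<le> det (mat n n (\<lambda>(i, j). K (x i) (y j))))"

definition TN ::
  "enat \<Rightarrow> 'a::linorder set \<Rightarrow> 'b::linorder set \<Rightarrow> ('a \<Rightarrow> 'b \<Rightarrow> real) \<Rightarrow> bool"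
where
  "TN p X Y K = (case p of enat q \<Rightarrow> TN_fin q X Y K | \<infinity> \<Rightarrow> (\<forall>q\<ge>1. TN_fin q X Y K))"

text \<open>For \<open>p = \<infinity>\<close> this says that the set is infinite.\<close>

definition card_at_least :: "enat \<Rightarrow> 'a set \<Rightarrow> bool" where
  "card_at_least p A \<longleftrightarrow> (finite A \<longrightarrow> p \<le> enat (card A))"

text \<open>
  Functions on \<open>[0, \<infinity>)\<close> are represented extensionally, so that equality of sets of such
  functions is not affected by values at negative arguments.  For \<open>p \<ge> 1\<close> a
  \<open>TN p\<close> kernel is nonnegative on \<open>X \<times> Y\<close>, so these values never enter the composition.
\<close>

definition TN_preservers ::
  "'a::linorder set \<Rightarrow> 'b::linorder set \<Rightarrow> enat \<Rightarrow> (real \<Rightarrow> real) set"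
where
  "TN_preservers X Y p =
     {F \<in> {0..} \<rightarrow>\<^sub>E UNIV.
        \<forall>K. TN p X Y K \<longrightarrow> TN p X Y (\<lambda>x y. F (K x y))}"

end

theory Submission
  imports Defs "HOL-Analysis.Convex" "HOL-Real_Asymp.Real_Asymp"
begin

text \<open>
  A totally nonnegative \<open>m \<times> m\<close> matrix padded by zeros is a totally nonnegative kernel on
  \<open>X \<times> Y\<close>, so preservers can be tested on small matrices.  For \<open>2 \<times> 2\<close> matrices, the singular
  ones give \<open>F (x * y) * F 1 = F x * F y\<close>, and \<open>F\<close> is monotone; hence \<open>F\<close> is a constant, a multiple of
  the indicator of \<open>x > 0\<close>, or a multiple of a power.  A tridiagonal \<open>3 \<times> 3\<close> matrix with
  entries in \<open>{0, 1, 2}\<close> forces the exponent to be at least 1, and every such exponent preserves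
  nonnegative determinants of order 3 by convexity.  In order 4, take \<open>J + t M\<close> with \<open>J\<close> the all-ones
  matrix and \<open>M\<close> singular: the determinant of its entrywise power \<open>\<alpha> > 1\<close> is
  \<open>- 2 \<alpha>\<^sup>3 (\<alpha> - 1) t\<^sup>4 + o(t\<^sup>4)\<close> as \<open>t\<close> tends to 0, so only \<open>\<alpha> = 1\<close> survives.
\<close>

subsection \<open>Determinants of small order\<close>

text \<open>Laplace expansion along row 0. The minors are again matrices given by an index function,
  so the rule can be iterated to expand small determinants.\<close>

lemma det_mat_Suc:
  fixes A :: "nat \<Rightarrow> nat \<Rightarrow> 'a::comm_ring_1"
  shows "det (mat (Suc n) (Suc n) (\<lambda>(i, j). A i j)) =
    (\<Sum>j<Suc n. (- 1) ^ j * A 0 j *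
       det (mat n n (\<lambda>(i, k). A (Suc i) (if k < j then k else Suc k))))"
proof -
  have "cofactor (mat (Suc n) (Suc n) (\<lambda>(i, j). A i j)) 0 j =
      (- 1) ^ j * det (mat n n (\<lambda>(i, k). A (Suc i) (if k < j then k else Suc k)))"
    if "j < Suc n" for j
    using that unfolding cofactor_def mat_delete_def
    by (auto intro!: arg_cong[where f="\<lambda>M. _ * det M"] cong_mat)
  then show ?thesis
    by (subst laplace_expansion_row[where n="Suc n" and i=0]) (auto simp: mult_ac intro!: sum.cong simp del: sum.lessThan_Suc)
qed

lemma det_mat_1: "det (mat 1 1 (\<lambda>(i, j). A i j)) = (A 0 0 :: 'a::comm_ring_1)"
  unfolding One_nat_def by (simp add: det_mat_Suc)

lemma det_mat_2:
  fixes A :: "nat \<Rightarrow> nat \<Rightarrow> 'a::comm_ring_1"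
  shows "det (mat 2 2 (\<lambda>(i,j). A i j)) = A 0 0 * A 1 1 - A 0 1 * A 1 0"
  unfolding numeral_2_eq_2 by (simp add: det_mat_Suc)

lemma det_mat_3:
  fixes A :: "nat \<Rightarrow> nat \<Rightarrow> 'a::comm_ring_1"
  shows "det (mat 3 3 (\<lambda>(i,j). A i j)) =
   A 0 0 * (A 1 1 * A 2 2 - A 1 2 * A 2 1)
 - A 0 1 * (A 1 0 * A 2 2 - A 1 2 * A 2 0)
 + A 0 2 * (A 1 0 * A 2 1 - A 1 1 * A 2 0)"
  unfolding numeral_3_eq_3
  by (simp add: det_mat_Suc numeral_2_eq_2)

text \<open>The first row and column of \<open>1 + B i j\<close> consist of ones. Subtracting the
  first row from the others leaves the lower right 3 x 3 block of \<open>B\<close>.\<close>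

lemma det_mat_4_border:
  fixes B :: "nat \<Rightarrow> nat \<Rightarrow> 'a::comm_ring_1"
  assumes "\<And>j. j < 4 \<Longrightarrow> B 0 j = 0" "\<And>i. i < 4 \<Longrightarrow> B i 0 = 0"
  shows "det (mat 4 4 (\<lambda>(i,j). 1 + B i j)) =
   B 1 1 * (B 2 2 * B 3 3 - B 2 3 * B 3 2)
 - B 1 2 * (B 2 1 * B 3 3 - B 2 3 * B 3 1)
 + B 1 3 * (B 2 1 * B 3 2 - B 2 2 * B 3 1)"
proof -
  have *: "4 = Suc 3" by simp
  show ?thesis unfolding * det_mat_Suc
    unfolding det_mat_3 by (simp add: numeral_2_eq_2 numeral_3_eq_3 assms)(simp add: algebra_simps)
qed

subsection \<open>Minors of kernels\<close>

lemma TN_fin_mono: "TN_fin q X Y K \<Longrightarrow> p \<le> q \<Longrightarrow> TN_fin p X Y K"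
  unfolding TN_fin_def by (meson order_trans)

lemma TN_fin_cong:
  assumes "\<And>x y. x \<in> X \<Longrightarrow> y \<in> Y \<Longrightarrow> K x y = K' x y"
  shows "TN_fin p X Y K \<longleftrightarrow> TN_fin p X Y K'"
proof -
  have "mat n n (\<lambda>(i, j). K (x i) (y j)) = mat n n (\<lambda>(i, j). K' (x i) (y j))"
    if "x \<in> {..<n} \<rightarrow> X" "y \<in> {..<n} \<rightarrow> Y" for n x y
    using that assms by (intro cong_mat) auto
  then show ?thesis unfolding TN_fin_def by (metis (no_types, lifting))
qed

lemma TN_fin_Suc:
  "TN_fin (Suc p) X Y K \<longleftrightarrow> TN_fin p X Y K \<and>
     (\<forall>x y. x \<in> {..<Suc p} \<rightarrow> X \<and> strict_mono_on {..<Suc p} x \<and>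
        y \<in> {..<Suc p} \<rightarrow> Y \<and> strict_mono_on {..<Suc p} y \<longrightarrow>
        0 \<le> det (mat (Suc p) (Suc p) (\<lambda>(i, j). K (x i) (y j))))"
  unfolding TN_fin_def le_Suc_eq by auto

lemma TN_fin_1: "TN_fin 1 X Y K \<longleftrightarrow> (\<forall>x\<in>X. \<forall>y\<in>Y. 0 \<le> K x y)"
proof -
  have "0 \<le> K a b" if "TN_fin 1 X Y K" "a \<in> X" "b \<in> Y" for a b
    using that unfolding TN_fin_def
    by (auto simp: det_mat_1[unfolded One_nat_def] strict_mono_on_def
        dest!: spec[of _ 1] spec[of _ "\<lambda>_. a"] spec[of _ "\<lambda>_. b"])
  moreover have "TN_fin 1 X Y K" if "\<forall>x\<in>X. \<forall>y\<in>Y. 0 \<le> K x y"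
    using that unfolding TN_fin_def
    by (auto simp: det_mat_1[unfolded One_nat_def] le_Suc_eq Pi_iff)
  ultimately show ?thesis by blast
qed

lemma TN_fin_2:
  "TN_fin 2 X Y K \<longleftrightarrow> TN_fin 1 X Y K \<and>
     (\<forall>x1\<in>X. \<forall>x2\<in>X. x1 < x2 \<longrightarrow> (\<forall>y1\<in>Y. \<forall>y2\<in>Y. y1 < y2 \<longrightarrow>
        K x1 y2 * K x2 y1 \<le> K x1 y1 * K x2 y2))"
  (is "_ \<longleftrightarrow> _ \<and> ?R")
proof -
  have "TN_fin 2 X Y K \<longleftrightarrow> TN_fin 1 X Y K \<and>
     (\<forall>x y. x \<in> {..<2::nat} \<rightarrow> X \<and> strict_mono_on {..<2} x \<and>
        y \<in> {..<2::nat} \<rightarrow> Y \<and> strict_mono_on {..<2} y \<longrightarrow>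
        0 \<le> K (x 0) (y 0) * K (x 1) (y 1) - K (x 0) (y 1) * K (x 1) (y 0))" (is "_ \<longleftrightarrow> _ \<and> ?D")
    using TN_fin_Suc[of 1 X Y K] by (simp only: det_mat_2 Suc_1)
  moreover have "?D \<longleftrightarrow> ?R"
  proof safe
    fix a b c d assume D: ?D and h: "a \<in> X" "b \<in> X" "a < b" "c \<in> Y" "d \<in> Y" "c < d"
    show "K a d * K b c \<le> K a c * K b d"
      using spec[OF spec[OF D, of "\<lambda>i. if i = 0 then a else b"], of "\<lambda>i. if i = 0 then c else d"] h
      by (auto simp: strict_mono_on_def)
  next
    fix x y assume R: ?R and h: "x \<in> {..<2} \<rightarrow> X" "strict_mono_on {..<2::nat} x"
      "y \<in> {..<2} \<rightarrow> Y" "strict_mono_on {..<2::nat} y"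
    show "0 \<le> K (x 0) (y 0) * K (x 1) (y 1) - K (x 0) (y 1) * K (x 1) (y 0)"
      using R h by (auto simp: strict_mono_on_def Pi_iff)
  qed
  ultimately show ?thesis by blast
qed

lemma TN_fin_3:
  "TN_fin 3 X Y K \<longleftrightarrow> TN_fin 2 X Y K \<and>
     (\<forall>x1\<in>X. \<forall>x2\<in>X. x1 < x2 \<longrightarrow> (\<forall>x3\<in>X. x2 < x3 \<longrightarrow>
        (\<forall>y1\<in>Y. \<forall>y2\<in>Y. y1 < y2 \<longrightarrow> (\<forall>y3\<in>Y. y2 < y3 \<longrightarrow>
        0 \<le> K x1 y1 * (K x2 y2 * K x3 y3 - K x2 y3 * K x3 y2)
          - K x1 y2 * (K x2 y1 * K x3 y3 - K x2 y3 * K x3 y1)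
          + K x1 y3 * (K x2 y1 * K x3 y2 - K x2 y2 * K x3 y1)))))"
  (is "_ \<longleftrightarrow> _ \<and> ?R")
proof -
  have "TN_fin 3 X Y K \<longleftrightarrow> TN_fin 2 X Y K \<and>
     (\<forall>x y. x \<in> {..<3::nat} \<rightarrow> X \<and> strict_mono_on {..<3} x \<and>
        y \<in> {..<3::nat} \<rightarrow> Y \<and> strict_mono_on {..<3} y \<longrightarrow>
        0 \<le> K (x 0) (y 0) * (K (x 1) (y 1) * K (x 2) (y 2) - K (x 1) (y 2) * K (x 2) (y 1))
          - K (x 0) (y 1) * (K (x 1) (y 0) * K (x 2) (y 2) - K (x 1) (y 2) * K (x 2) (y 0))
          + K (x 0) (y 2) * (K (x 1) (y 0) * K (x 2) (y 1) - K (x 1) (y 1) * K (x 2) (y 0)))"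
    (is "_ \<longleftrightarrow> _ \<and> ?D")
  proof -
    have "Suc 2 = 3" by simp
    then show ?thesis using TN_fin_Suc[of 2 X Y K] by (simp only: det_mat_3)
  qed
  moreover have "?D \<longleftrightarrow> ?R"
  proof safe
    fix a b c a' b' c' assume D: ?D and h: "a \<in> X" "b \<in> X" "a < b" "c \<in> X" "b < c"
      "a' \<in> Y" "b' \<in> Y" "a' < b'" "c' \<in> Y" "b' < c'"
    have m: "strict_mono_on {..<3::nat} (\<lambda>i. if i = 0 then u else if i = 1 then v else w)"
      if "u < v" "v < w" for u v w :: "'x::linorder"
      using that by (auto simp: strict_mono_on_def)
    show "0 \<le> K a a' * (K b b' * K c c' - K b c' * K c b')
          - K a b' * (K b a' * K c c' - K b c' * K c a')
          + K a c' * (K b a' * K c b' - K b b' * K c a')"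
      using spec[OF spec[OF D, of "\<lambda>i. if i = 0 then a else if i = 1 then b else c"],
          of "\<lambda>i. if i = 0 then a' else if i = 1 then b' else c'"] h
        m[of a b c] m[of a' b' c'] by simp
  next
    fix x y assume R: ?R and h: "x \<in> {..<3} \<rightarrow> X" "strict_mono_on {..<3::nat} x"
      "y \<in> {..<3} \<rightarrow> Y" "strict_mono_on {..<3::nat} y"
    have "x 0 \<in> X" "x 1 \<in> X" "x 2 \<in> X" "y 0 \<in> Y" "y 1 \<in> Y" "y 2 \<in> Y"
      "x 0 < x 1" "x 1 < x 2" "y 0 < y 1" "y 1 < y 2"
      using h by (auto simp: strict_mono_on_def)
    then show "0 \<le> K (x 0) (y 0) * (K (x 1) (y 1) * K (x 2) (y 2) - K (x 1) (y 2) * K (x 2) (y 1))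
          - K (x 0) (y 1) * (K (x 1) (y 0) * K (x 2) (y 2) - K (x 1) (y 2) * K (x 2) (y 0))
          + K (x 0) (y 2) * (K (x 1) (y 0) * K (x 2) (y 1) - K (x 1) (y 1) * K (x 2) (y 0))"
      using R by blast
  qed
  ultimately show ?thesis by blast
qed

lemma TN_fin_nonneg:
  assumes "TN_fin p X Y K" "1 \<le> p" "x \<in> X" "y \<in> Y"
  shows "0 \<le> K x y"
  using TN_fin_mono[OF assms(1,2)] assms(3,4) unfolding TN_fin_1 by blast

subsection \<open>Preserving functions\<close>

lemma TN_fin_scale:
  assumes "TN_fin p X Y K" "c \<ge> 0"
  shows "TN_fin p X Y (\<lambda>x y. c * K x y)"
proof -
  have "mat n n (\<lambda>(i, j). c * K (x i) (y j)) = c \<cdot>\<^sub>m mat n n (\<lambda>(i, j). K (x i) (y j))" for n x y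
    by (rule eq_matI) auto
  then show ?thesis using assms unfolding TN_fin_def by simp
qed

lemma TN_fin_const:
  assumes "c \<ge> 0"
  shows "TN_fin p X Y (\<lambda>x y. c)"
proof -
  have "0 \<le> det (mat n n (\<lambda>(i, j). c))" if "1 \<le> n" for n
  proof (cases "n = 1")
    case True
    then show ?thesis using assms det_mat_1[of "\<lambda>_ _. c"] by simp
  next
    case False
    have "det (mat n n (\<lambda>(i, j). c)) = 0"
      by (rule det_identical_rows[where n=n and i=0 and j=1]) (use that False in \<open>auto intro!: eq_vecI\<close>)
    then show ?thesis by simp
  qed
  then show ?thesis unfolding TN_fin_def by blast
qed

text \<open>If both entries off the diagonal are positive, the minor inequality forces a positive
  product on the diagonal, hence two positive diagonal entries.\<close>

lemma TN_fin_2_indicator: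
  assumes "TN_fin 2 X Y K"
  shows "TN_fin 2 X Y (\<lambda>x y. of_bool (K x y > 0))"
  unfolding TN_fin_2 TN_fin_1
proof (intro conjI ballI impI)
  fix x1 x2 y1 y2 assume h: "x1 \<in> X" "x2 \<in> X" "x1 < x2" "y1 \<in> Y" "y2 \<in> Y" "y1 < y2"
  then have "K x1 y2 * K x2 y1 \<le> K x1 y1 * K x2 y2" "0 \<le> K x1 y1" "0 \<le> K x2 y2"
    using assms unfolding TN_fin_2 TN_fin_1 by auto
  moreover from this have "0 < K x1 y1 \<and> 0 < K x2 y2" if "0 < K x1 y2" "0 < K x2 y1"
    using mult_pos_pos[OF that] by (auto simp: order.order_iff_strict)
  ultimately show "of_bool (0 < K x1 y2) * of_bool (0 < K x2 y1)
      \<le> (of_bool (0 < K x1 y1) * of_bool (0 < K x2 y2) :: real)"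
    by auto
qed simp

lemma TN_fin_2_powr:
  assumes "TN_fin 2 X Y K" "\<alpha> \<ge> 0"
  shows "TN_fin 2 X Y (\<lambda>x y. K x y powr \<alpha>)"
  using assms unfolding TN_fin_2 TN_fin_1
  by (auto simp: powr_mult[symmetric] intro!: powr_mono2)

text \<open>Convexity: the graph lies above its tangent at \<open>v\<close>. For positive
  \<open>u\<close> and \<open>v\<close> this is Young's inequality for
  \<open>u powr \<alpha>\<close> and \<open>v powr \<alpha>\<close> with weights
  \<open>1 / \<alpha>\<close> and \<open>1 - 1 / \<alpha>\<close>.\<close>

lemma powr_tangent:
  fixes u v \<alpha> :: real
  assumes "u \<ge> 0" "v \<ge> 0" "\<alpha> \<ge> 1"
  shows "\<alpha> * (u - v) * v powr (\<alpha> - 1) \<le> u powr \<alpha> - v powr \<alpha>"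
\<comment> \<open>Since \<open>0 powr 0 = 0\<close>, the slope at \<open>v = 0\<close> counts as 0
  even for \<alpha> = 1; the bound still holds.\<close>
proof (cases "v = 0 \<or> u = 0")
  case True
  have "v powr \<alpha> = v * v powr (\<alpha> - 1)"
    using powr_mult_base[of v "\<alpha> - 1"] assms by simp
  moreover have "v * v powr (\<alpha> - 1) \<le> \<alpha> * (v * v powr (\<alpha> - 1))"
    using assms mult_right_mono[of 1 \<alpha> "v * v powr (\<alpha> - 1)"] by simp
  ultimately show ?thesis using True assms by (auto simp: algebra_simps)
next
  case False
  hence "u > 0" "v > 0" using assms by auto
  then have "(u powr \<alpha>) powr (1 / \<alpha>) * (v powr \<alpha>) powr (1 - 1 / \<alpha>)
      \<le> 1 / \<alpha> * u powr \<alpha> + (1 - 1 / \<alpha>) * v powr \<alpha>"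
    using assms by (intro Youngs_inequality_0) auto
  also have "(u powr \<alpha>) powr (1 / \<alpha>) = u"
    using \<open>u > 0\<close> assms by (simp add: powr_powr)
  also have "(v powr \<alpha>) powr (1 - 1 / \<alpha>) = v powr (\<alpha> - 1)"
    using assms by (simp add: powr_powr right_diff_distrib)
  finally have "\<alpha> * (u * v powr (\<alpha> - 1)) \<le> u powr \<alpha> + (\<alpha> - 1) * v powr \<alpha>"
    using assms by (simp add: field_simps)
  moreover have "v powr \<alpha> = v * v powr (\<alpha> - 1)"
    using powr_mult_base[of v "\<alpha> - 1"] \<open>v > 0\<close> by simp
  ultimately show ?thesis by (simp add: algebra_simps)
qed

text \<open>
  For a nonzero central entry this is Sylvester's identity
  \<open>e det = (ae - bd)(ei - fh) - (bf - ce)(dh - eg)\<close>, in which all four differences are bounded by tangent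
  lines of the convex function \<open>x\<^sup>\<alpha>\<close> whose slopes have the same product on both sides.
\<close>

lemma det_3_powr_nonneg:
  fixes a b c d e f g h i \<alpha> :: real
  assumes nn: "a \<ge> 0" "b \<ge> 0" "c \<ge> 0" "d \<ge> 0" "e \<ge> 0" "f \<ge> 0" "g \<ge> 0" "h \<ge> 0" "i \<ge> 0"
    and m: "b * d \<le> a * e" "c * e \<le> b * f" "e * g \<le> d * h" "f * h \<le> e * i"
    and det: "0 \<le> a * (e * i - f * h) - b * (d * i - f * g) + c * (d * h - e * g)"
    and \<alpha>: "\<alpha> \<ge> 1"
  shows "0 \<le> a powr \<alpha> * (e powr \<alpha> * i powr \<alpha> - f powr \<alpha> * h powr \<alpha>)
     - b powr \<alpha> * (d powr \<alpha> * i powr \<alpha> - f powr \<alpha> * g powr \<alpha>)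
     + c powr \<alpha> * (d powr \<alpha> * h powr \<alpha> - e powr \<alpha> * g powr \<alpha>)"
proof (cases "e = 0")
  case True
  \<comment> \<open>After this only the nonnegative products of \<open>b\<close>, \<open>f\<close>,
    \<open>g\<close> and of \<open>c\<close>, \<open>d\<close>, \<open>h\<close> survive.\<close>
  then have "b * d = 0" "f * h = 0" using m nn by (auto intro!: antisym mult_nonneg_nonneg simp del: mult_eq_0_iff)
  then show ?thesis using True by auto
next
  case False
  let ?p = "\<lambda>x. x powr \<alpha>"
  define s where "s x = \<alpha> * x powr (\<alpha> - 1)" for x
  have s: "s x \<ge> 0" for x using \<alpha> by (simp add: s_def)
  have lower: "(u - v) * s v \<le> ?p u - ?p v" if "u \<ge> 0" "v \<ge> 0" for u v
    using powr_tangent[OF that \<alpha>] by (simp add: s_def mult_ac)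
  have upper: "?p u - ?p v \<le> (u - v) * s u" if "u \<ge> 0" "v \<ge> 0" for u v
    using lower[OF that(2,1)] by (simp add: algebra_simps)
  have "(b * f - c * e) * (d * h - e * g) \<le> (a * e - b * d) * (e * i - f * h)"
  proof -
    have "0 \<le> e * (a * (e * i - f * h) - b * (d * i - f * g) + c * (d * h - e * g))"
      using det nn by simp
    then show ?thesis by (simp add: algebra_simps)
  qed
  \<comment> \<open>Both sides equal
    \<open>\<alpha>\<^sup>2 * (b * d * f * h) powr (\<alpha> - 1)\<close>.\<close>
  moreover have "s (b * f) * s (d * h) = s (b * d) * s (f * h)"
    using nn by (simp add: s_def powr_mult mult_ac)
  ultimately have "((b * f - c * e) * (d * h - e * g)) * (s (b * f) * s (d * h))
      \<le> ((a * e - b * d) * (e * i - f * h)) * (s (b * d) * s (f * h))"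
    by (auto intro!: mult_right_mono simp: s)
  then have slope: "((b * f - c * e) * s (b * f)) * ((d * h - e * g) * s (d * h))
      \<le> ((a * e - b * d) * s (b * d)) * ((e * i - f * h) * s (f * h))"
    by (simp only: mult_ac)
  \<comment> \<open>Differences are bounded above with the slope at the larger point, and below
    (after \<open>slope\<close>) with the slope at the smaller one.\<close>
  have "(?p (b * f) - ?p (c * e)) * (?p (d * h) - ?p (e * g))
      \<le> ((b * f - c * e) * s (b * f)) * ((d * h - e * g) * s (d * h))"
    using nn m \<alpha> s by (intro mult_mono upper) (auto intro!: powr_mono2)
  also note slope
  also have "((a * e - b * d) * s (b * d)) * ((e * i - f * h) * s (f * h))
      \<le> (?p (a * e) - ?p (b * d)) * (?p (e * i) - ?p (f * h))"
    using nn m \<alpha> s by (intro mult_mono lower) (auto intro!: powr_mono2)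
  finally have "0 \<le> ?p e * (?p a * (?p e * ?p i - ?p f * ?p h) - ?p b * (?p d * ?p i - ?p f * ?p g)
      + ?p c * (?p d * ?p h - ?p e * ?p g))"
    using nn by (simp add: powr_mult algebra_simps)
  moreover have "?p e > 0" using False by simp
  ultimately show ?thesis by (simp add: zero_le_mult_iff)
qed

lemma TN_fin_3_powr:
  assumes K: "TN_fin 3 X Y K" and \<alpha>: "\<alpha> \<ge> 1"
  shows "TN_fin 3 X Y (\<lambda>x y. K x y powr \<alpha>)"
  unfolding TN_fin_3
proof (intro conjI ballI impI)
  show "TN_fin 2 X Y (\<lambda>x y. K x y powr \<alpha>)"
    using K \<alpha> by (intro TN_fin_2_powr) (auto simp: TN_fin_3)
next
  fix x1 x2 x3 y1 y2 y3
  assume h: "x1 \<in> X" "x2 \<in> X" "x1 < x2" "x3 \<in> X" "x2 < x3"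
    "y1 \<in> Y" "y2 \<in> Y" "y1 < y2" "y3 \<in> Y" "y2 < y3"
  have nn: "0 \<le> K x y" if "x \<in> X" "y \<in> Y" for x y
    using TN_fin_nonneg[OF K] that by simp
  have m: "K x y' * K x' y \<le> K x y * K x' y'"
    if "x \<in> X" "x' \<in> X" "x < x'" "y \<in> Y" "y' \<in> Y" "y < y'" for x x' y y'
    using K that by (auto simp: TN_fin_3 TN_fin_2)
  show "0 \<le> K x1 y1 powr \<alpha> * (K x2 y2 powr \<alpha> * K x3 y3 powr \<alpha> - K x2 y3 powr \<alpha> * K x3 y2 powr \<alpha>)
     - K x1 y2 powr \<alpha> * (K x2 y1 powr \<alpha> * K x3 y3 powr \<alpha> - K x2 y3 powr \<alpha> * K x3 y1 powr \<alpha>)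
     + K x1 y3 powr \<alpha> * (K x2 y1 powr \<alpha> * K x3 y2 powr \<alpha> - K x2 y2 powr \<alpha> * K x3 y1 powr \<alpha>)"
    using K h by (intro det_3_powr_nonneg nn m \<alpha>) (auto simp: TN_fin_3)
qed

subsection \<open>Zero padding\<close>

lemma det_zero_row:
  fixes A :: "nat \<Rightarrow> nat \<Rightarrow> 'a::comm_ring_1"
  assumes "i < n" "\<And>j. j < n \<Longrightarrow> A i j = 0"
  shows "det (mat n n (\<lambda>(i, j). A i j)) = 0"
  using assms by (subst laplace_expansion_row[where n=n and i=i]) auto

lemma det_zero_column:
  fixes A :: "nat \<Rightarrow> nat \<Rightarrow> 'a::comm_ring_1"
  assumes "j < n" "\<And>i. i < n \<Longrightarrow> A i j = 0"
  shows "det (mat n n (\<lambda>(i, j). A i j)) = 0"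
  using assms by (subst laplace_expansion_column[where n=n and j=j]) auto

lemma card_at_least_embedding:
  fixes X :: "'a::linorder set"
  assumes "card_at_least p X" "enat m \<le> p"
  obtains e where "e \<in> {..<m} \<rightarrow> X" "strict_mono_on {..<m} e"
proof -
  have "\<exists>S\<subseteq>X. finite S \<and> card S = m"
  proof (cases "finite X")
    case True
    then have "m \<le> card X" using assms by (auto simp: card_at_least_def dest: order_trans)
    then show ?thesis using obtain_subset_with_card_n by metis
  next
    case False
    then show ?thesis using infinite_arbitrarily_large by metis
  qed
  then obtain S where S: "S \<subseteq> X" "finite S" "card S = m" by blast
  define l where "l = sorted_list_of_set S"
  have l: "set l = S" "sorted_wrt (<) l" "length l = m"
    using S by (auto simp: l_def)
  show ?thesis
  proof (rule that[of "\<lambda>i. l ! i"])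
    show "(\<lambda>i. l ! i) \<in> {..<m} \<rightarrow> X" using S l by (auto simp: subset_iff)
    show "strict_mono_on {..<m} (\<lambda>i. l ! i)"
      using l by (auto simp: strict_mono_on_def sorted_wrt_iff_nth_less)
  qed
qed

text \<open>\<open>A\<close> is placed on an m x m grid inside X x Y and extended by 0. A minor that
  leaves the grid has a zero row or column; any other is a minor of \<open>A\<close>. The value of
  \<open>F\<close> at 0 is harmless, because after composition only the minor on the grid itself is
  read off.\<close>

lemma TN_preservers_det_nonneg:
  fixes X :: "'a::linorder set" and Y :: "'b::linorder set"
  assumes F: "F \<in> TN_preservers X Y p"
    and X: "card_at_least p X" and Y: "card_at_least p Y"
    and m: "1 \<le> m" "enat m \<le> p"
    and A: "TN_fin m {..<m} {..<m} A"
  shows "0 \<le> det (mat m m (\<lambda>(i, j). F (A i j)))"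
proof -
  obtain e where e: "e \<in> {..<m} \<rightarrow> X" "strict_mono_on {..<m} e"
    using card_at_least_embedding[OF X m(2)] by blast
  obtain f where f: "f \<in> {..<m} \<rightarrow> Y" "strict_mono_on {..<m} f"
    using card_at_least_embedding[OF Y m(2)] by blast
  let ?e = "inv_into {..<m} e" and ?f = "inv_into {..<m} f"
  define K where "K x y = (if x \<in> e ` {..<m} \<and> y \<in> f ` {..<m} then A (?e x) (?f y) else 0)" for x y
  \<comment> \<open>Increasing tuples in the image of \<open>g\<close> pull back to increasing
    indices below \<open>m\<close>; injectivity then gives \<open>n \<le> m\<close>, so the
    hypothesis on \<open>A\<close> covers every such minor.\<close>
  have inv_mono: "strict_mono_on {..<n} (inv_into {..<m} g \<circ> x) \<and> inv_into {..<m} g \<circ> x \<in> {..<n} \<rightarrow> {..<m} \<and> n \<le> m"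
    if "strict_mono_on {..<n} x" "strict_mono_on {..<m} g" "\<forall>i<n. x i \<in> g ` {..<m}"
    for g :: "nat \<Rightarrow> 'x::linorder" and x :: "nat \<Rightarrow> 'x" and n
  proof -
    have "strict_mono_on {..<n} (inv_into {..<m} g \<circ> x)"
    proof (rule strict_mono_onI)
      fix i j assume ij: "i \<in> {..<n}" "j \<in> {..<n}" "i < j"
      have "x i < x j" using that(1) ij by (auto simp: strict_mono_on_def)
      then have "g (inv_into {..<m} g (x i)) < g (inv_into {..<m} g (x j))"
        using that(3) ij by (simp add: f_inv_into_f)
      moreover have "inv_into {..<m} g (x k) \<in> {..<m}" if "k < n" for k
        using \<open>\<forall>i<n. x i \<in> g ` {..<m}\<close> that by (intro inv_into_into) auto
      ultimately show "(inv_into {..<m} g \<circ> x) i < (inv_into {..<m} g \<circ> x) j"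
        using strict_mono_on_less[OF that(2)] ij by auto
    qed
    moreover have range: "inv_into {..<m} g \<circ> x \<in> {..<n} \<rightarrow> {..<m}"
      using that(3) inv_into_into[of _ g "{..<m}"] by fastforce
    ultimately show ?thesis
      using card_inj_on_le[OF strict_mono_on_imp_inj_on, of "{..<n}" "inv_into {..<m} g \<circ> x" "{..<m}"]
      by (simp add: image_subset_iff_funcset o_def)
  qed
  \<comment> \<open>Every order \<open>q\<close> is needed, since \<open>p\<close> may be infinite
    or larger than \<open>m\<close>.\<close>
  have K: "TN_fin q X Y K" for q
    unfolding TN_fin_def
  proof (intro allI impI, elim conjE)
    fix n and x :: "nat \<Rightarrow> 'a" and y :: "nat \<Rightarrow> 'b"
    assume n: "1 \<le> n" and x: "strict_mono_on {..<n} x" and y: "strict_mono_on {..<n} y"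
    consider i where "i < n" "x i \<notin> e ` {..<m}" | j where "j < n" "y j \<notin> f ` {..<m}"
      | "\<forall>i<n. x i \<in> e ` {..<m}" "\<forall>j<n. y j \<in> f ` {..<m}"
      by blast
    then show "0 \<le> det (mat n n (\<lambda>(i, j). K (x i) (y j)))"
    proof cases
      case 1
      then have "det (mat n n (\<lambda>(i, j). K (x i) (y j))) = 0" by (intro det_zero_row) (auto simp: K_def)
      then show ?thesis by simp
    next
      case 2
      then have "det (mat n n (\<lambda>(i, j). K (x i) (y j))) = 0" by (intro det_zero_column) (auto simp: K_def)
      then show ?thesis by simp
    next
      case 3
      have "mat n n (\<lambda>(i, j). K (x i) (y j)) = mat n n (\<lambda>(i, j). A ((?e \<circ> x) i) ((?f \<circ> y) j))"
        using 3 by (intro cong_mat) (auto simp: K_def)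
      moreover have "0 \<le> det (mat n n (\<lambda>(i, j). A ((?e \<circ> x) i) ((?f \<circ> y) j)))"
        using A[unfolded TN_fin_def] n inv_mono[OF x e(2) 3(1)] inv_mono[OF y f(2) 3(2)] by blast
      ultimately show ?thesis by simp
    qed
  qed
  have "TN p X Y K" using K by (auto simp: TN_def split: enat.splits)
  then have "TN p X Y (\<lambda>x y. F (K x y))" using F by (auto simp: TN_preservers_def)
  then have "TN_fin m X Y (\<lambda>x y. F (K x y))"
    using m by (auto simp: TN_def intro: TN_fin_mono split: enat.splits)
  then have "0 \<le> det (mat m m (\<lambda>(i, j). F (K (e i) (f j))))"
    using e f m unfolding TN_fin_def by blast
  also have "mat m m (\<lambda>(i, j). F (K (e i) (f j))) = mat m m (\<lambda>(i, j). F (A i j))"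
    using strict_mono_on_imp_inj_on[OF e(2)] strict_mono_on_imp_inj_on[OF f(2)]
    by (intro cong_mat) (auto simp: K_def)
  finally show ?thesis .
qed

subsection \<open>Necessary conditions\<close>

text \<open>Squeezing \<open>n * x\<close> between consecutive integers bounds the error at
  \<open>x\<close>, multiplied by \<open>n\<close>, by \<open>h 1\<close> for all \<open>n\<close>;
  the Archimedean property makes the error vanish.\<close>

lemma additive_mono_linear:
  fixes h :: "real \<Rightarrow> real"
  assumes add: "\<And>x y. h (x + y) = h x + h y" and mono: "\<And>x y. x \<le> y \<Longrightarrow> h x \<le> h y"
  shows "h x = h 1 * x"
proof -
  have h0: "h 0 = 0" using add[of 0 0] by simp
  have h_nat: "h (of_nat n * x) = of_nat n * h x" for n x
    by (induction n) (simp_all add: h0 add algebra_simps)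
  have h_minus: "h (- x) = - h x" for x using add[of x "- x"] h0 by simp
  have h_int: "h (of_int k) = of_int k * h 1" for k
  proof (cases k rule: int_cases2)
    case (nonneg n) then show ?thesis using h_nat[of n 1] by simp
  next
    case (nonpos n) then show ?thesis using h_nat[of n 1] h_minus by simp
  qed
  have "h 1 \<ge> 0" using mono[of 0 1] h0 by simp
  have "of_nat n * \<bar>h x - h 1 * x\<bar> \<le> h 1" for n
  proof -
    let ?k = "\<lfloor>of_nat n * x\<rfloor>"
    have "of_int ?k * h 1 \<le> of_nat n * h x" "of_nat n * h x \<le> (of_int ?k + 1) * h 1"
      using mono[of "of_int ?k" "of_nat n * x"] mono[of "of_nat n * x" "of_int (?k + 1)"]
      unfolding h_int h_nat by auto
    moreover have "of_int ?k * h 1 \<le> (of_nat n * x) * h 1" "(of_nat n * x) * h 1 \<le> (of_int ?k + 1) * h 1"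
      using \<open>h 1 \<ge> 0\<close> by (intro mult_right_mono; simp)+
    ultimately have "\<bar>of_nat n * h x - (of_nat n * x) * h 1\<bar> \<le> h 1"
      by (simp add: algebra_simps abs_le_iff)
    also have "of_nat n * h x - (of_nat n * x) * h 1 = of_nat n * (h x - h 1 * x)"
      by (simp add: algebra_simps)
    finally show ?thesis by (simp add: abs_mult)
  qed
  then have "\<bar>h x - h 1 * x\<bar> \<le> 0"
    by (meson ex_less_of_nat_mult not_le)
  then show ?thesis by simp
qed

lemma order_2_preserving_cases:
  fixes F :: "real \<Rightarrow> real"
  assumes nn: "\<And>x. 0 \<le> x \<Longrightarrow> 0 \<le> F x"
    and det: "\<And>a b c d. \<lbrakk>0 \<le> a; 0 \<le> b; 0 \<le> c; 0 \<le> d; b * c \<le> a * d\<rbrakk> \<Longrightarrow> F b * F c \<le> F a * F d"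
  obtains (const) c where "c \<ge> 0" "\<And>x. 0 \<le> x \<Longrightarrow> F x = c"
    | (indicator) c where "c > 0" "\<And>x. 0 \<le> x \<Longrightarrow> F x = c * of_bool (x > 0)"
    | (power) c \<alpha> where "c > 0" "\<alpha> > 0" "\<And>x. 0 \<le> x \<Longrightarrow> F x = c * x powr \<alpha>"
proof -
  \<comment> \<open>The matrix with rows (x * y, x) and (y, 1) is singular, so \<open>det\<close>
    applies in both directions.\<close>
  have mult: "F (x * y) * F 1 = F x * F y" if "0 \<le> x" "0 \<le> y" for x y
    using det[of "x * y" x y 1] det[of x "x * y" 1 y] that by (intro antisym) auto
  have mono: "F x \<le> F y" if "0 \<le> x" "x \<le> y" for x y
  proof -
    have "x * x \<le> y * y" using that by (intro mult_mono) auto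
    then have "F x * F x \<le> F y * F y" using det[of y x x y] that by simp
    then show ?thesis using nn[of y] that by (metis abs_le_square_iff abs_of_nonneg nn order_trans power2_eq_square)
  qed
  consider "F 1 = 0" | "F 1 \<noteq> 0" "F 0 \<noteq> 0" | "F 1 \<noteq> 0" "F 0 = 0" by blast
  then show thesis
  proof cases
    case 1
    then have "F x = 0" if "0 \<le> x" for x using mult[of x x] that by simp
    then show thesis using const[of 0] by simp
  next
    case 2
    \<comment> \<open>The relation reads \<open>F 0 * F 1 = F 0 * F x\<close>, and
      \<open>F 0\<close> cancels.\<close>
    then have "F x = F 1" if "0 \<le> x" for x using mult[of 0 x] that by simp
    from const[OF nn[OF zero_le_one] this] show thesis .
  next
    case 3
    have F1: "F 1 > 0" using nn[of 1] 3 by simp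
    have pos: "F x > 0" if "x > 0" for x
    proof -
      have "F x * F (1 / x) = F 1 * F 1" using mult[of x "1 / x"] that by simp
      then have "F x \<noteq> 0" using F1 by auto
      then show ?thesis using nn[of x] that by simp
    qed
    \<comment> \<open>Logarithmic coordinates turn multiplicativity on the positive reals into
      additivity; the slope \<open>h 1\<close> is the exponent. If it is 0, then
      \<open>F 0 = 0\<close> gives the indicator.\<close>
    define h where "h s = ln (F (exp s) / F 1)" for s
    have "h (s + t) = h s + h t" for s t
    proof -
      have "F (exp (s + t)) / F 1 = (F (exp s) / F 1) * (F (exp t) / F 1)"
        using mult[of "exp s" "exp t"] F1 by (simp add: exp_add field_simps)
      then show ?thesis using pos[of "exp s"] pos[of "exp t"] F1 unfolding h_def by (simp add: ln_mult ln_div)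
    qed
    moreover have h_mono: "h s \<le> h t" if "s \<le> t" for s t
      using mono[of "exp s" "exp t"] that pos[of "exp s"] pos[of "exp t"] F1
      unfolding h_def by (simp add: divide_right_mono)
    ultimately have h: "h s = h 1 * s" for s by (rule additive_mono_linear)
    have "h 1 \<ge> 0" using h_mono[of 0 1] h[of 0] by simp
    have F: "F x = F 1 * x powr h 1" if "x > 0" for x
    proof -
      have "ln (F x / F 1) = h 1 * ln x" using h[of "ln x"] that by (simp add: h_def)
      then have "F x / F 1 = exp (h 1 * ln x)"
        using pos[OF that] F1 by (metis divide_pos_pos exp_ln)
      then show ?thesis using F1 that by (simp add: powr_def field_simps)
    qed
    show thesis
    proof (cases "h 1 = 0")
      case True
      then have "F x = F 1 * of_bool (x > 0)" if "0 \<le> x" for x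
        using F[of x] 3 that by (cases "x = 0") auto
      then show thesis using indicator F1 by blast
    next
      case False
      then have "F x = F 1 * x powr h 1" if "0 \<le> x" for x
        using F[of x] 3 that by (cases "x = 0") auto
      moreover have "h 1 > 0" using False \<open>h 1 \<ge> 0\<close> by simp
      ultimately show thesis using power[OF F1] by blast
    qed
  qed
qed

section \<open>Order 3: excluding exponents below 1\<close>

lemma TN_fin_tridiagonal:
  "TN_fin 3 {..<3} {..<3} (\<lambda>i j. [[1, 1, 0], [1, 2, 1], [0, 1, 1]] ! i ! j :: real)"
  unfolding TN_fin_3 TN_fin_2 TN_fin_1
  by (simp add: lessThan_Suc numeral_eq_Suc)

text \<open>The tridiagonal matrix is singular, and applying \<open>F\<close> changes its
  determinant to \<open>c ^ 3 * (2 powr \<alpha> - 2)\<close>. Only the values at 0, 1 and 2 are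
  prescribed, so the indicator is covered too, as \<alpha> = 0.\<close>

lemma powr_preserver_ge_1:
  fixes \<alpha> :: real
  assumes "0 \<le> det (mat 3 3 (\<lambda>(i, j). F ([[1, 1, 0], [1, 2, 1], [0, 1, 1]] ! i ! j)))"
    and "F 0 = 0" "F 1 = c" "F 2 = c * 2 powr \<alpha>" "c > 0"
  shows "\<alpha> \<ge> 1"
proof -
  have "0 \<le> c ^ 3 * (2 powr \<alpha> - 2)"
    using assms(1) unfolding det_mat_3 by (simp add: assms(2-4) algebra_simps power3_eq_cube)
  then have "2 powr 1 \<le> (2 powr \<alpha> :: real)"
    using assms(5) by (simp add: zero_le_mult_iff)
  then show ?thesis by (subst (asm) powr_le_cancel_iff) auto
qed

section \<open>Order 4: excluding exponents above 1\<close>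

text \<open>
  The lower right \<open>3 \<times> 3\<close> block is \<open>L P Q U\<close> with \<open>P\<close> and \<open>Q\<close> totally nonnegative of sizes
  \<open>3 \<times> 2\<close> and \<open>2 \<times> 3\<close> and with \<open>L\<close>, \<open>U\<close> the triangular all-ones matrices; this makes
  \<open>J + t M\<close> totally nonnegative.  The block must not be symmetric: by the Schur
  product theorem, a positive semidefinite one would give a nonnegative leading term.
\<close>

definition rank_2_matrix :: "nat \<Rightarrow> nat \<Rightarrow> real" where
  "rank_2_matrix i j = [[0, 0, 0, 0], [0, 1, 2, 2], [0, 2, 4, 5], [0, 3, 6, 8]] ! i ! j"

lemma rank_2_matrix_border:
  assumes "i < 4"
  shows "rank_2_matrix 0 i = 0" "rank_2_matrix i 0 = 0"
  using assms by (auto simp: rank_2_matrix_def numeral_eq_Suc less_Suc_eq)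

text \<open>Subtracting twice the first column from the second leaves columns divisible by
  \<open>t\<close>, \<open>t ^ 2\<close> and \<open>t\<close>.\<close>

lemma det_3_column_operation:
  fixes t :: "'a::comm_ring_1"
  assumes "a1 = t * u1" "a2 = t * u2" "a3 = t * u3"
    and "b1 = 2 * a1 + t ^ 2 * w1" "b2 = 2 * a2 + t ^ 2 * w2" "b3 = 2 * a3 + t ^ 2 * w3"
    and "c1 = t * v1" "c2 = t * v2" "c3 = t * v3"
  shows "a1 * (b2 * c3 - c2 * b3) - b1 * (a2 * c3 - c2 * a3) + c1 * (a2 * b3 - b2 * a3) =
    t ^ 4 * (u1 * (w2 * v3 - v2 * w3) - w1 * (u2 * v3 - v2 * u3) + v1 * (u2 * w3 - w2 * u3))"
  unfolding assms by (simp add: algebra_simps power2_eq_square power4_eq_xxxx)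

text \<open>The all-ones matrix has rank one, so orders 0 and 1 in \<open>t\<close> vanish. The
  coefficient of \<open>t ^ 2\<close> is the determinant with a row of ones above the differences of
  rows 2 and 3 from row 1.\<close>

lemma minor_3_perturbed_ones:
  fixes t :: "'a::comm_ring_1"
  shows "(1 + t * a) * ((1 + t * e) * (1 + t * i) - (1 + t * f) * (1 + t * h))
     - (1 + t * b) * ((1 + t * d) * (1 + t * i) - (1 + t * f) * (1 + t * g))
     + (1 + t * c) * ((1 + t * d) * (1 + t * h) - (1 + t * e) * (1 + t * g)) =
    t ^ 2 * ((e - b) * (i - c) - (f - c) * (h - b) - (d - a) * (i - c) + (f - c) * (g - a)
       + (d - a) * (h - b) - (e - b) * (g - a))
    + t ^ 3 * (a * (e * i - f * h) - b * (d * i - f * g) + c * (d * h - e * g))"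
  by (simp add: algebra_simps power2_eq_square power3_eq_cube)

lemma minor_2_perturbed_ones:
  fixes t a b c d :: real
  assumes "t \<ge> 0" "b + c \<le> a + d" "b * c \<le> a * d"
  shows "(1 + t * b) * (1 + t * c) \<le> (1 + t * a) * (1 + t * d)"
proof -
  have "0 \<le> t * (a + d - b - c) + t ^ 2 * (a * d - b * c)"
    using assms by simp
  then show ?thesis by (simp add: algebra_simps power2_eq_square)
qed

lemma increasing_triple_below_4:
  fixes a b c :: nat
  assumes "a < b" "b < c" "c < 4"
  shows "a = 0 \<and> b = 1 \<and> c = 2 \<or> a = 0 \<and> b = 1 \<and> c = 3 \<or> a = 0 \<and> b = 2 \<and> c = 3 \<or> a = 1 \<and> b = 2 \<and> c = 3"
  using assms by linarith

lemma increasing_pair_below_4: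
  fixes a b :: nat
  assumes "a < b" "b < 4"
  shows "a = 0 \<and> b = 1 \<or> a = 0 \<and> b = 2 \<or> a = 0 \<and> b = 3 \<or> a = 1 \<and> b = 2 \<or> a = 1 \<and> b = 3 \<or> a = 2 \<and> b = 3"
  using assms by linarith

text \<open>Minors of orders 2 and 3 are polynomials in \<open>t\<close> whose coefficients are
  found nonnegative by checking all index choices. The single minor of order 4 vanishes, since the
  second column of the 3 x 3 block is twice the first.\<close>

lemma TN_fin_perturbed_ones:
  assumes "t \<ge> 0"
  shows "TN_fin 4 {..<4} {..<4} (\<lambda>i j. 1 + t * rank_2_matrix i j)"
proof -
  let ?M = rank_2_matrix
  have M: "\<forall>i<4. \<forall>j<4. 0 \<le> ?M i j"
    by (simp add: rank_2_matrix_def numeral_eq_Suc All_less_Suc)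
  have minor_2: "?M x1 y2 + ?M x2 y1 \<le> ?M x1 y1 + ?M x2 y2 \<and> ?M x1 y2 * ?M x2 y1 \<le> ?M x1 y1 * ?M x2 y2"
    if "x1 < x2" "x2 < 4" "y1 < y2" "y2 < 4" for x1 x2 y1 y2
    using increasing_pair_below_4[OF that(1,2)] increasing_pair_below_4[OF that(3,4)]
    by (elim disjE conjE; simp add: rank_2_matrix_def)
  have minor_3:
    "0 \<le> (?M x2 y2 - ?M x1 y2) * (?M x3 y3 - ?M x1 y3) - (?M x2 y3 - ?M x1 y3) * (?M x3 y2 - ?M x1 y2)
         - (?M x2 y1 - ?M x1 y1) * (?M x3 y3 - ?M x1 y3) + (?M x2 y3 - ?M x1 y3) * (?M x3 y1 - ?M x1 y1)
         + (?M x2 y1 - ?M x1 y1) * (?M x3 y2 - ?M x1 y2) - (?M x2 y2 - ?M x1 y2) * (?M x3 y1 - ?M x1 y1) \<and>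
     0 \<le> ?M x1 y1 * (?M x2 y2 * ?M x3 y3 - ?M x2 y3 * ?M x3 y2)
         - ?M x1 y2 * (?M x2 y1 * ?M x3 y3 - ?M x2 y3 * ?M x3 y1)
         + ?M x1 y3 * (?M x2 y1 * ?M x3 y2 - ?M x2 y2 * ?M x3 y1)"
    if "x1 < x2" "x2 < x3" "x3 < 4" "y1 < y2" "y2 < y3" "y3 < 4" for x1 x2 x3 y1 y2 y3
    using increasing_triple_below_4[OF that(1-3)] increasing_triple_below_4[OF that(4-6)]
    by (elim disjE conjE; simp add: rank_2_matrix_def)
  have T2: "TN_fin 2 {..<4} {..<4} (\<lambda>i j. 1 + t * ?M i j)"
    unfolding TN_fin_2 TN_fin_1 using assms minor_2 M
    by (auto intro!: minor_2_perturbed_ones add_nonneg_nonneg)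
  have "0 \<le> t ^ 2 * a + t ^ 3 * b" if "0 \<le> a \<and> 0 \<le> b" for a b
    using assms that by simp
  note nonneg = this[OF minor_3]
  have T3: "TN_fin 3 {..<4} {..<4} (\<lambda>i j. 1 + t * ?M i j)"
    unfolding TN_fin_3 minor_3_perturbed_ones
    by (intro conjI ballI impI; (fact T2 | rule nonneg; simp))
  have index: "x i = i" if "x \<in> {..<4} \<rightarrow> {..<4}" "strict_mono_on {..<4} x" "i < 4" for x :: "nat \<Rightarrow> nat" and i
  proof -
    have "x 0 < x 1" "x 1 < x 2" "x 2 < x 3" "x 3 < 4"
      using that by (auto simp: strict_mono_on_def Pi_iff)
    moreover have "i = 0 \<or> i = 1 \<or> i = 2 \<or> i = 3" using that by auto
    ultimately show ?thesis by auto
  qed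
  have "det (mat 4 4 (\<lambda>(i, j). 1 + t * ?M i j)) = 0"
    by (subst det_mat_4_border)
      (auto simp: rank_2_matrix_border, simp add: rank_2_matrix_def)
  moreover have "mat 4 4 (\<lambda>(i, j). 1 + t * ?M (x i) (y j)) = mat 4 4 (\<lambda>(i, j). 1 + t * ?M i j)"
    if "x \<in> {..<4} \<rightarrow> {..<4}" "strict_mono_on {..<4} x" "y \<in> {..<4} \<rightarrow> {..<4}" "strict_mono_on {..<4} y" for x y
    using index[OF that(1,2)] index[OF that(3,4)] by (intro cong_mat) auto
  ultimately have minor_4: "0 \<le> det (mat 4 4 (\<lambda>(i, j). 1 + t * ?M (x i) (y j)))"
    if "x \<in> {..<4} \<rightarrow> {..<4}" "strict_mono_on {..<4} x" "y \<in> {..<4} \<rightarrow> {..<4}" "strict_mono_on {..<4} y" for x y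
    using that by simp
  have "Suc 3 = 4" by simp
  from TN_fin_Suc[of 3 "{..<4::nat}" "{..<4::nat}", unfolded this] T3 minor_4 show ?thesis
    by blast
qed

lemma perturbed_ones_powr_det_neg:
  fixes \<alpha> :: real
  assumes "\<alpha> > 1"
  obtains t where "t \<ge> 0" "det (mat 4 4 (\<lambda>(i, j). (1 + t * rank_2_matrix i j) powr \<alpha>)) < 0"
proof -
  let ?h = "\<lambda>t m. (1 + t * m) powr \<alpha> - 1"
  \<comment> \<open>The block entries 2, 4, 6 double 1, 2, 3, so the column operation brings in the
    second-order quotient \<open>?w\<close>. \<open>?f\<close> is the determinant with columns
    \<open>?u\<close> at 1, 2, 3, then \<open>?w\<close> at 1, 2, 3, then \<open>?u\<close> at 2, 5,
    8.\<close>
  let ?u = "\<lambda>t m. ?h t m / t" and ?w = "\<lambda>t m. (?h t (2 * m) - 2 * ?h t m) / t ^ 2"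
  let ?f = "\<lambda>t. ?u t 1 * (?w t 2 * ?u t 8 - ?u t 5 * ?w t 3)
      - ?w t 1 * (?u t 2 * ?u t 8 - ?u t 5 * ?u t 3)
      + ?u t 2 * (?u t 2 * ?w t 3 - ?w t 2 * ?u t 3)"
  have u: "((\<lambda>t. ?u t m) \<longlongrightarrow> \<alpha> * m) (at_right 0)" if "m > 0" for m
    using that by real_asymp
  have w: "((\<lambda>t. ?w t m) \<longlongrightarrow> \<alpha> * (m * (m * (\<alpha> - 1)))) (at_right 0)" if "m > 0" for m
    using that assms by real_asymp
  \<comment> \<open>The limit is left unsimplified so that each factor matches \<open>u\<close> or
    \<open>w\<close>.\<close>
  have "(?f \<longlongrightarrow> (\<alpha> * 1) * ((\<alpha> * (2 * (2 * (\<alpha> - 1)))) * (\<alpha> * 8) - (\<alpha> * 5) * (\<alpha> * (3 * (3 * (\<alpha> - 1)))))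
      - (\<alpha> * (1 * (1 * (\<alpha> - 1)))) * ((\<alpha> * 2) * (\<alpha> * 8) - (\<alpha> * 5) * (\<alpha> * 3))
      + (\<alpha> * 2) * ((\<alpha> * 2) * (\<alpha> * (3 * (3 * (\<alpha> - 1)))) - (\<alpha> * (2 * (2 * (\<alpha> - 1)))) * (\<alpha> * 3))) (at_right 0)"
    (is "(_ \<longlongrightarrow> ?l) _")
    by (intro tendsto_add tendsto_diff tendsto_mult u w; simp)
  moreover have "?l = - 2 * \<alpha> ^ 3 * (\<alpha> - 1)"
    by (simp add: algebra_simps power3_eq_cube)
  then have "?l < 0" using assms by (simp add: mult_pos_pos)
  ultimately have "eventually (\<lambda>t. ?f t < 0) (at_right 0)"
    by (rule order_tendstoD(2))
  moreover have "eventually (\<lambda>t::real. t > 0) (at_right 0)"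
    by (simp add: eventually_at_filter)
  ultimately have "eventually (\<lambda>t. ?f t < 0 \<and> t > 0) (at_right 0)"
    by (rule eventually_conj)
  then obtain t where t: "?f t < 0" "t > 0"
    using eventually_happens' by (metis (no_types, lifting) trivial_limit_at_right_real)
  have "det (mat 4 4 (\<lambda>(i, j). (1 + t * rank_2_matrix i j) powr \<alpha>)) =
      det (mat 4 4 (\<lambda>(i, j). 1 + ?h t (rank_2_matrix i j)))"
    by simp
  also have "\<dots> =
      ?h t 1 * (?h t 4 * ?h t 8 - ?h t 5 * ?h t 6)
      - ?h t 2 * (?h t 2 * ?h t 8 - ?h t 5 * ?h t 3)
      + ?h t 2 * (?h t 2 * ?h t 6 - ?h t 4 * ?h t 3)"
    by (subst det_mat_4_border[where B="\<lambda>i j. ?h t (rank_2_matrix i j)"];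
        (simp only: rank_2_matrix_border)?; simp add: rank_2_matrix_def)
  also have "\<dots> = t ^ 4 * ?f t"
  proof -
    have u: "?h t m = t * ?u t m" for m
      using t by simp
    have w: "?h t (2 * m) = 2 * ?h t m + t ^ 2 * ?w t m" for m
      using t by simp
    show ?thesis
      using w[of 1] w[of 2] w[of 3]
      by (intro det_3_column_operation u) simp_all
  qed
  finally show thesis using that[of t] t by (simp add: mult_pos_neg)
qed

section \<open>Classification of the preservers\<close>

text \<open>Order 1 makes \<open>K\<close> nonnegative, so restricting \<open>f\<close> does not
  change the composition on X x Y.\<close>

lemma restrict_in_TN_preservers:
  assumes p: "1 \<le> p" and f: "\<And>K. TN p X Y K \<Longrightarrow> TN p X Y (\<lambda>x y. f (K x y))"
  shows "restrict f {0..} \<in> TN_preservers X Y p"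
proof -
  have "TN p X Y (\<lambda>x y. restrict f {0..} (K x y))" if K: "TN p X Y K" for K
  proof -
    have "TN_fin 1 X Y K"
      using K p by (auto simp: TN_def one_enat_def intro: TN_fin_mono split: enat.splits)
    then have "restrict f {0..} (K x y) = f (K x y)" if "x \<in> X" "y \<in> Y" for x y
      using that unfolding TN_fin_1 by simp
    then have "TN_fin q X Y (\<lambda>x y. restrict f {0..} (K x y)) = TN_fin q X Y (\<lambda>x y. f (K x y))" for q
      by (rule TN_fin_cong)
    then show ?thesis using f[OF K] by (simp add: TN_def split: enat.splits)
  qed
  then show ?thesis by (auto simp: TN_preservers_def)
qed

lemma const_in_TN_preservers:
  "1 \<le> p \<Longrightarrow> 0 \<le> c \<Longrightarrow> (\<lambda>x\<in>{0..}. c) \<in> TN_preservers X Y p"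
  by (rule restrict_in_TN_preservers) (auto simp: TN_def TN_fin_const split: enat.splits)

lemma scale_in_TN_preservers:
  "1 \<le> p \<Longrightarrow> 0 \<le> c \<Longrightarrow> (\<lambda>x\<in>{0..}. c * x) \<in> TN_preservers X Y p"
  by (rule restrict_in_TN_preservers) (auto simp: TN_def TN_fin_scale split: enat.splits)

lemma TN_2: "TN 2 = TN_fin 2" and TN_3: "TN 3 = TN_fin 3"
  by (intro ext, simp add: TN_def numeral_eq_enat)+

text \<open>Stated for all \<open>p \<ge> 2\<close>, so that the higher orders start from these
  three cases and discard some of them. Extensionality turns the pointwise description into an
  equality of functions.\<close>

lemma TN_preserver_2_cases:
  assumes F: "F \<in> TN_preservers X Y p" and p: "2 \<le> p"
    and X: "card_at_least p X" and Y: "card_at_least p Y"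
  obtains (const) c where "c \<ge> 0" "F = (\<lambda>x\<in>{0..}. c)"
    | (indicator) c where "c > 0" "F = (\<lambda>x\<in>{0..}. c * of_bool (x > 0))"
    | (power) c \<alpha> where "c > 0" "\<alpha> > 0" "F = (\<lambda>x\<in>{0..}. c * x powr \<alpha>)"
proof -
  note det = TN_preservers_det_nonneg[OF F X Y]
  have p': "enat 1 \<le> p" "enat 2 \<le> p"
    using p order_trans[of 1 2 p] by (simp_all add: numeral_eq_enat one_enat_def)
  have nn: "0 \<le> F x" if "0 \<le> x" for x
  proof -
    have "TN_fin 1 {..<1::nat} {..<1::nat} (\<lambda>_ _. x)"
      using that unfolding TN_fin_1 by simp
    from det[OF order_refl p'(1) this] show ?thesis unfolding det_mat_1 .
  qed
  have det_2: "F b * F c \<le> F a * F d"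
    if "0 \<le> a" "0 \<le> b" "0 \<le> c" "0 \<le> d" "b * c \<le> a * d" for a b c d
  proof -
    let ?A = "\<lambda>i j. if i = 0 then (if j = 0 then a else b) else if j = 0 then c else d"
    have "TN_fin 2 {..<2::nat} {..<2::nat} ?A"
      using that unfolding TN_fin_2 TN_fin_1 by auto
    from det[OF _ p'(2) this] show ?thesis unfolding det_mat_2 by simp
  qed
  have "F \<in> extensional {0..}"
    using F by (simp add: TN_preservers_def PiE_iff)
  then have ext: "F = restrict f {0..}" if "\<And>x. 0 \<le> x \<Longrightarrow> F x = f x" for f
    by (rule extensionalityI[OF _ restrict_extensional]) (simp add: that)
  show thesis
  proof (rule order_2_preserving_cases[of F])
    show "0 \<le> F x" if "0 \<le> x" for x
      using that by (rule nn)
    show "F b * F c \<le> F a * F d"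
      if "0 \<le> a" "0 \<le> b" "0 \<le> c" "0 \<le> d" "b * c \<le> a * d" for a b c d
      using that by (rule det_2)
  next
    fix c assume "c \<ge> 0" and F: "\<And>x. 0 \<le> x \<Longrightarrow> F x = c"
    then show thesis by (intro const ext)
  next
    fix c assume "c > 0" and F: "\<And>x. 0 \<le> x \<Longrightarrow> F x = c * of_bool (x > 0)"
    then show thesis by (intro indicator ext)
  next
    fix c \<alpha> assume "c > 0" "\<alpha> > 0" and F: "\<And>x. 0 \<le> x \<Longrightarrow> F x = c * x powr \<alpha>"
    then show thesis by (intro power ext)
  qed
qed

lemma TN_preserver_3_cases:
  assumes F: "F \<in> TN_preservers X Y p" and p: "3 \<le> p"
    and X: "card_at_least p X" and Y: "card_at_least p Y"
  obtains (const) c where "c \<ge> 0" "F = (\<lambda>x\<in>{0..}. c)"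
    | (power) c \<alpha> where "c > 0" "\<alpha> \<ge> 1" "F = (\<lambda>x\<in>{0..}. c * x powr \<alpha>)"
proof -
  have p': "2 \<le> p" "enat 3 \<le> p"
    using p order_trans[of 2 3 p] by (simp_all add: numeral_eq_enat)
  have det: "0 \<le> det (mat 3 3 (\<lambda>(i, j). F ([[1, 1, 0], [1, 2, 1], [0, 1, 1]] ! i ! j)))"
    using TN_preservers_det_nonneg[OF F X Y _ p'(2) TN_fin_tridiagonal] by simp
  from F p'(1) X Y show thesis
  proof (cases rule: TN_preserver_2_cases)
    case (const c)
    then show thesis by (rule that(1))
  next
    case (indicator c)
    \<comment> \<open>At 0, 1 and 2 the indicator agrees with a power of exponent 0.\<close>
    then have "1 \<le> (0::real)"
      by (intro powr_preserver_ge_1[OF det, of c]) auto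
    then show thesis by simp
  next
    case (power c \<alpha>)
    then have "1 \<le> \<alpha>"
      by (intro powr_preserver_ge_1[OF det, of c]) auto
    with power show thesis using that(2) by blast
  qed
qed

lemma TN_preserver_4_cases:
  assumes F: "F \<in> TN_preservers X Y p" and p: "4 \<le> p"
    and X: "card_at_least p X" and Y: "card_at_least p Y"
  obtains (const) c where "c \<ge> 0" "F = (\<lambda>x\<in>{0..}. c)"
    | (scale) c where "c > 0" "F = (\<lambda>x\<in>{0..}. c * x)"
proof -
  have p': "3 \<le> p" "enat 4 \<le> p"
    using p order_trans[of 3 4 p] by (simp_all add: numeral_eq_enat)
  from F p'(1) X Y show thesis
  proof (cases rule: TN_preserver_3_cases)
    case (const c)
    then show thesis by (rule that(1))
  next
    case (power c \<alpha>)
    have "\<alpha> = 1"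
    proof (rule ccontr)
      assume "\<alpha> \<noteq> 1"
      then have "\<alpha> > 1" using power by simp
      then obtain t where t: "t \<ge> 0" "det (mat 4 4 (\<lambda>(i, j). (1 + t * rank_2_matrix i j) powr \<alpha>)) < 0"
        by (rule perturbed_ones_powr_det_neg)
      note TN = TN_fin_perturbed_ones[OF t(1)]
      let ?P = "mat 4 4 (\<lambda>(i, j). (1 + t * rank_2_matrix i j) powr \<alpha>)"
      \<comment> \<open>Nonnegative entries lie in the domain of the restricted \<open>F\<close>;
        the factor \<open>c\<close> contributes \<open>c ^ 4 > 0\<close> to the determinant.\<close>
      have "mat 4 4 (\<lambda>(i, j). F (1 + t * rank_2_matrix i j)) = c \<cdot>\<^sub>m ?P"
        using TN_fin_nonneg[OF TN] by (intro eq_matI) (auto simp: power)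
      then have "0 \<le> c ^ 4 * det ?P"
        using TN_preservers_det_nonneg[OF F X Y _ p'(2) TN] by simp
      moreover have "c ^ 4 * det ?P < 0" using t(2) power by (intro mult_pos_neg) auto
      ultimately show False by simp
    qed
    then have "F = (\<lambda>x\<in>{0..}. c * x)"
      unfolding power by (intro restrict_ext) simp
    with power show thesis using that(2) by blast
  qed
qed

theorem theorem6p3:
  fixes X :: "'a::linorder set" and Y :: "'b::linorder set" and p :: enat
  assumes "2 \<le> p"
    and "card_at_least p X"
    and "card_at_least p Y"
  shows
    "(p = 2 \<longrightarrow>
        TN_preservers X Y p =
          {(\<lambda>x\<in>{0..}. c * x powr \<alpha>) | c \<alpha>. c > 0 \<and> \<alpha> > 0} \<union>
          {(\<lambda>x\<in>{0..}. c) | c. c \<ge> 0} \<union>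
          {(\<lambda>x\<in>{0..}. c * of_bool (x > 0)) | c. c > 0}) \<and>
     (p = 3 \<longrightarrow>
        TN_preservers X Y p =
          {(\<lambda>x\<in>{0..}. c * x powr \<alpha>) | c \<alpha>. c > 0 \<and> \<alpha> \<ge> 1} \<union>
          {(\<lambda>x\<in>{0..}. c) | c. c \<ge> 0}) \<and>
     (4 \<le> p \<longrightarrow>
        TN_preservers X Y p =
          {(\<lambda>x\<in>{0..}. c * x) | c. c > 0} \<union>
          {(\<lambda>x\<in>{0..}. c) | c. c \<ge> 0})"
proof (intro conjI impI)
  have p1: "1 \<le> p" using assms(1) order_trans[of 1 2 p] by simp
  note const = const_in_TN_preservers[OF p1]
  {
    assume p: "p = 2"
    \<comment> \<open>In each range of \<open>p\<close> the case lemma gives necessity, and the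
      membership facts give sufficiency.\<close>
    have "F \<in> {(\<lambda>x\<in>{0..}. c * x powr \<alpha>) | c \<alpha>. c > 0 \<and> \<alpha> > 0} \<union>
          {(\<lambda>x\<in>{0..}. c) | c. c \<ge> 0} \<union> {(\<lambda>x\<in>{0..}. c * of_bool (x > 0)) | c. c > 0}"
      if "F \<in> TN_preservers X Y p" for F
      using that assms by (cases rule: TN_preserver_2_cases) blast+
    moreover have "(\<lambda>x\<in>{0..}. c * x powr \<alpha>) \<in> TN_preservers X Y p" if "c > 0" "\<alpha> > 0" for c \<alpha>
      using that unfolding p
      by (intro restrict_in_TN_preservers) (auto simp: TN_2 intro!: TN_fin_scale TN_fin_2_powr)
    moreover have "(\<lambda>x\<in>{0..}. c * of_bool (x > 0)) \<in> TN_preservers X Y p" if "c > 0" for c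
      using that unfolding p
      by (intro restrict_in_TN_preservers) (simp, simp only: TN_2, intro TN_fin_scale TN_fin_2_indicator, auto)
    ultimately show "TN_preservers X Y p =
          {(\<lambda>x\<in>{0..}. c * x powr \<alpha>) | c \<alpha>. c > 0 \<and> \<alpha> > 0} \<union>
          {(\<lambda>x\<in>{0..}. c) | c. c \<ge> 0} \<union> {(\<lambda>x\<in>{0..}. c * of_bool (x > 0)) | c. c > 0}"
      using const by blast
  next
    assume p: "p = 3"
    then have "3 \<le> p" by simp
    have "F \<in> {(\<lambda>x\<in>{0..}. c * x powr \<alpha>) | c \<alpha>. c > 0 \<and> \<alpha> \<ge> 1} \<union> {(\<lambda>x\<in>{0..}. c) | c. c \<ge> 0}"
      if "F \<in> TN_preservers X Y p" for F
      using that \<open>3 \<le> p\<close> assms(2,3) by (cases rule: TN_preserver_3_cases) blast+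
    moreover have "(\<lambda>x\<in>{0..}. c * x powr \<alpha>) \<in> TN_preservers X Y p" if "c > 0" "\<alpha> \<ge> 1" for c \<alpha>
      using that unfolding p
      by (intro restrict_in_TN_preservers) (auto simp: TN_3 intro!: TN_fin_scale TN_fin_3_powr)
    ultimately show "TN_preservers X Y p =
          {(\<lambda>x\<in>{0..}. c * x powr \<alpha>) | c \<alpha>. c > 0 \<and> \<alpha> \<ge> 1} \<union> {(\<lambda>x\<in>{0..}. c) | c. c \<ge> 0}"
      using const by blast
  next
    assume p: "4 \<le> p"
    have "F \<in> {(\<lambda>x\<in>{0..}. c * x) | c. c > 0} \<union> {(\<lambda>x\<in>{0..}. c) | c. c \<ge> 0}"
      if "F \<in> TN_preservers X Y p" for F
      using that p assms(2,3) by (cases rule: TN_preserver_4_cases) blast+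
    then show "TN_preservers X Y p =
          {(\<lambda>x\<in>{0..}. c * x) | c. c > 0} \<union> {(\<lambda>x\<in>{0..}. c) | c. c \<ge> 0}"
      using const scale_in_TN_preservers[OF p1, of _ X Y] by (auto simp: less_imp_le)
  }
qed

end
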